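(* Let $\mathcal{S}$ be the set of all maximal singly generated multiplicatively closed subsets of $\mathbb{N}$. The map $\mathcal{S}\to\mathbb{PF}^{\infty}_{\mathbb{Q}_{\ge0}}$ which sends $\mathbb{S}=\{f^n\mid n\in\mathbb{N}\cup\{0\}\}$, where $f=\prod_{j=1}^{k}p_{i_j}^{r_{i_j}}$ with primes $p_{i_1}<p_{i_2}<\dots<p_{i_k}$ and $r_{i_1},\dots,r_{i_k}\in\mathbb{N}$, to the point $$P=[\ldots:r_{i_1}:\ldots:r_{i_2}:\ldots:r_{i_k}:\ldots]$$ (the class of the vector of exponents of $f$, with coordinate $r_{i_j}$ at the position $i_j$ and $0$ at all other positions) is a bijection between maximal singly generated multiplicatively closed sets and points of $\mathbb{PF}^{\infty}_{\mathbb{Q}_{\ge0}}$.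
   Context: $\mathbb{N}$ is the set of positive integers, and $p_i$ denotes the $i$-th prime ($p_1=2,p_2=3,p_3=5,\dots$). A set $\mathbb{S}\subset\mathbb{N}$ is singly generated multiplicatively closed if $\mathbb{S}=\{1,f,f^2,\ldots\}$ for some $f\in\mathbb{N}$, $f\ne1$. It is maximal if whenever $\mathbb{T}$ is a singly generated multiplicatively closed set with $\mathbb{T}\supset\mathbb{S}$, then $\mathbb{T}=\mathbb{S}$. $\mathbb{PF}^{\infty}_{\mathbb{Q}_{\ge0}}$ is the quotient of the set of nonzero finitely supported sequences $(a_1,a_2,\ldots)$ of non-negative rationals by the relation: $(a_i)\sim(b_i)$ iff there is a positive rational $\lambda$ with $a_i=\lambda b_i$ for all $i\ge1$. Coordinates are indexed by the primes in increasing order. *)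

theory Defs
  imports Complex_Main "HOL-Library.Infinite_Set" "HOL-Computational_Algebra.Primes"
begin

text \<open>The positive integers are the \<open>f :: nat\<close> with \<open>f > 0\<close>.\<close>

definition powers :: "nat \<Rightarrow> nat set" where
  "powers f = {f ^ n | n. True}"

definition is_generator :: "nat \<Rightarrow> nat set \<Rightarrow> bool" where
  "is_generator f S \<longleftrightarrow> f > 0 \<and> f \<noteq> 1 \<and> S = powers f"

definition singly_generated :: "nat set \<Rightarrow> bool" where
  "singly_generated S \<longleftrightarrow> (\<exists>f. is_generator f S)"

definition maximal_singly_generated :: "nat set set" where
  "maximal_singly_generated =
     {S. singly_generated S \<and> (\<forall>T. singly_generated T \<longrightarrow> S \<subseteq> T \<longrightarrow> T = S)}"

text \<open>Sequences are indexed from 0, so coordinate \<open>i\<close> belongs to \<open>nth_prime i\<close>,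
  where \<open>nth_prime 0 = 2\<close>, \<open>nth_prime 1 = 3\<close>, \<open>nth_prime 2 = 5\<close>, and so on.\<close>

definition nth_prime :: "nat \<Rightarrow> nat" where
  "nth_prime i = enumerate {p. prime p} i"

definition nonzero_seqs :: "(nat \<Rightarrow> rat) set" where
  "nonzero_seqs = {a. finite {i. a i \<noteq> 0} \<and> (\<forall>i. a i \<ge> 0) \<and> (\<exists>i. a i \<noteq> 0)}"

definition proj_rel :: "((nat \<Rightarrow> rat) \<times> (nat \<Rightarrow> rat)) set" where
  "proj_rel = {(a, b). a \<in> nonzero_seqs \<and> b \<in> nonzero_seqs \<and>
                       (\<exists>c>0. \<forall>i. a i = c * b i)}"

lemma equiv_proj_rel: "equiv nonzero_seqs proj_rel"
proof (rule equivI)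
  show "proj_rel \<subseteq> nonzero_seqs \<times> nonzero_seqs"
    by (auto simp: proj_rel_def)
  show "refl_on nonzero_seqs proj_rel"
    by (auto simp: refl_on_def proj_rel_def intro: exI[of _ 1])
  show "sym proj_rel"
  proof (rule symI)
    fix a b assume "(a, b) \<in> proj_rel"
    then obtain c where c: "a \<in> nonzero_seqs" "b \<in> nonzero_seqs" "c > 0" "\<forall>i. a i = c * b i"
      by (auto simp: proj_rel_def)
    then have "inverse c > 0" "\<forall>i. b i = inverse c * a i"
      by (simp_all add: field_simps)
    with c show "(b, a) \<in> proj_rel"
      unfolding proj_rel_def by blast
  qed
  show "trans proj_rel"
  proof (rule transI)
    fix a b d assume "(a, b) \<in> proj_rel" "(b, d) \<in> proj_rel"
    then obtain c e where c: "a \<in> nonzero_seqs" "d \<in> nonzero_seqs" "c > 0" "e > 0"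
      "\<forall>i. a i = c * b i" "\<forall>i. b i = e * d i"
      by (auto simp: proj_rel_def)
    then have "c * e > 0" "\<forall>i. a i = (c * e) * d i"
      by (simp_all add: mult.assoc)
    with c show "(a, d) \<in> proj_rel"
      unfolding proj_rel_def by blast
  qed
qed

text \<open>The space $\mathbb{PF}^{\infty}_{\mathbb{Q}_{\ge 0}}$.\<close>

definition PF_inf :: "(nat \<Rightarrow> rat) set set" where
  "PF_inf = nonzero_seqs // proj_rel"

definition proj_point :: "(nat \<Rightarrow> rat) \<Rightarrow> (nat \<Rightarrow> rat) set" where
  "proj_point a = proj_rel `` {a}"

definition exponent_seq :: "nat \<Rightarrow> nat \<Rightarrow> rat" where
  "exponent_seq f = (\<lambda>i. of_nat (multiplicity (nth_prime i) f))"

text \<open>The generator of a singly generated set is unique (it is the least element greater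
  than 1), so the description is proper there; the value on other sets is irrelevant.\<close>

definition exponent_point :: "nat set \<Rightarrow> (nat \<Rightarrow> rat) set" where
  "exponent_point S = proj_point (exponent_seq (THE f. is_generator f S))"

end

theory Submission
  imports Defs "HOL-Computational_Algebra.Nth_Powers"
begin

text \<open>If the exponent vectors of \<open>f\<close> and \<open>g\<close> are proportional, then \<open>f ^ a = g ^ b\<close> for
  coprime positive \<open>a, b\<close>, so \<open>f\<close> and \<open>g\<close> are powers of one number \<open>h\<close>; this gives injectivity,
  since maximality forces \<open>f = h = g\<close>. For surjectivity, clear denominators
  to obtain some \<open>f\<close> in the given class and pass to a maximal set containing \<open>f\<close>: its generator
  is a root of \<open>f\<close>, which has the same class.\<close>

section \<open>Generators and maximal singly generated sets\<close>

lemma power_eq_self_iff_nat: "f ^ n = f \<longleftrightarrow> n = 1" if "f > (1::nat)"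
  using that power_inject_exp[of f n 1] by simp

lemma is_generator_gt_1: "is_generator f S \<Longrightarrow> f > 1"
  by (auto simp: is_generator_def)

text \<open>Each generator is a power of the other, so \<open>f = f ^ (n * m)\<close>, and
  \<open>f > 1\<close> forces \<open>n = m = 1\<close>. This makes the \<open>THE\<close> in
  \<open>exponent_point\<close> well defined.\<close>

lemma generator_unique:
  assumes "is_generator f S" "is_generator g S"
  shows "f = g"
proof -
  have gt: "f > 1" "g > 1" and eq: "powers f = powers g"
    using assms by (auto simp: is_generator_def)
  have "f \<in> powers f" "g \<in> powers g"
    unfolding powers_def by (metis (mono_tags) mem_Collect_eq power_one_right)+
  then obtain m n where "f = g ^ m" "g = f ^ n"
    using eq unfolding powers_def by blast
  then have "f ^ (n * m) = f"
    by (simp add: power_mult)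
  then have "n * m = 1"
    using gt power_eq_self_iff_nat by blast
  then show ?thesis
    using \<open>f = g ^ m\<close> by simp
qed

lemma the_generator: "is_generator f S \<Longrightarrow> (THE f. is_generator f S) = f"
  using generator_unique by blast

lemma powers_subset_iff: "powers f \<subseteq> powers g \<longleftrightarrow> (\<exists>n. f = g ^ n)"
proof
  assume "powers f \<subseteq> powers g"
  moreover have "f \<in> powers f"
    unfolding powers_def by (metis (mono_tags) mem_Collect_eq power_one_right)
  ultimately show "\<exists>n. f = g ^ n"
    by (auto simp: powers_def)
next
  assume "\<exists>n. f = g ^ n"
  then show "powers f \<subseteq> powers g"
    by (auto simp: powers_def simp flip: power_mult)
qed

text \<open>The smallest admissible \<open>h\<close> works: if \<open>powers h\<close> lies in
  \<open>powers g\<close>, then \<open>h\<close> is a power of \<open>g\<close>, so \<open>g\<close>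
  is admissible and at most \<open>h\<close>, hence equal to it.\<close>

lemma singly_generated_imp_subset_maximal:
  assumes "f > 1"
  obtains h where "h > 1" "powers h \<in> maximal_singly_generated" "powers f \<subseteq> powers h"
proof -
  define h where "h = (LEAST h. h > 1 \<and> powers f \<subseteq> powers h)"
  have h: "h > 1 \<and> powers f \<subseteq> powers h"
    unfolding h_def by (rule LeastI[of _ f]) (use assms in simp)
  have least: "h \<le> g" if "g > 1" "powers f \<subseteq> powers g" for g
    unfolding h_def by (rule Least_le) (use that in simp)
  have max: "powers g = powers h" if g: "g > 1" "powers h \<subseteq> powers g" for g
  proof -
    obtain n where n: "h = g ^ n"
      using g powers_subset_iff by blast
    \<comment> \<open>Exponent 0 would give \<open>h = 1\<close>.\<close>
    with h have "n > 0"
      by (intro gr0I) auto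
    then have "g \<le> h"
      using n g by (simp add: self_le_power)
    moreover have "h \<le> g"
      using g h by (intro least) auto
    ultimately show ?thesis
      by simp
  qed
  have "T = powers h" if "singly_generated T" "powers h \<subseteq> T" for T
  proof -
    obtain g where g: "is_generator g T"
      using \<open>singly_generated T\<close> by (auto simp: singly_generated_def)
    then have "T = powers g"
      by (simp add: is_generator_def)
    with that max[OF is_generator_gt_1[OF g]] show ?thesis
      by simp
  qed
  moreover have "singly_generated (powers h)"
    unfolding singly_generated_def is_generator_def using h by (intro exI[of _ h]) simp
  ultimately have "powers h \<in> maximal_singly_generated"
    by (simp add: maximal_singly_generated_def)
  with h show ?thesis
    using that by blast
qed

section \<open>Exponent sequences and common roots\<close>

lemma bij_betw_nth_prime: "bij_betw nth_prime UNIV {p. prime p}"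
  unfolding nth_prime_def[abs_def] by (rule bij_enumerate) (rule primes_infinite)

lemma prime_nth_prime: "prime (nth_prime i)"
  using bij_betw_nth_prime by (auto simp: bij_betw_def)

lemma exponent_seq_power: "f > 0 \<Longrightarrow> exponent_seq (f ^ n) i = of_nat n * exponent_seq f i"
  by (simp add: exponent_seq_def prime_elem_multiplicity_power_distrib prime_nth_prime)

text \<open>Unique factorization: \<open>nth_prime\<close> reaches every prime, so all
  multiplicities agree.\<close>

lemma exponent_seq_inject:
  assumes "f > 0" "g > 0" "\<And>i. exponent_seq f i = exponent_seq g i"
  shows "f = g"
proof (rule multiplicity_eq_nat)
  fix p :: nat
  assume "prime p"
  then obtain i where "p = nth_prime i"
    using bij_betw_nth_prime by (auto simp: bij_betw_def)
  with assms(3)[of i] show "multiplicity p f = multiplicity p g"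
    by (simp add: exponent_seq_def)
qed (use assms in auto)

lemma exponent_seq_in_nonzero_seqs:
  assumes "f > 1"
  shows "exponent_seq f \<in> nonzero_seqs"
proof -
  have "nth_prime ` {i. exponent_seq f i \<noteq> 0} \<subseteq> prime_factors f"
    by (auto simp: exponent_seq_def prime_factors_multiplicity prime_nth_prime)
  then have "finite {i. exponent_seq f i \<noteq> 0}"
    using bij_betw_nth_prime finite_subset
    by (metis bij_betw_def finite_imageD finite_set_mset inj_on_subset subset_UNIV)
  \<comment> \<open>A zero sequence would be that of 1, forcing \<open>f = 1\<close>.\<close>
  moreover have "\<exists>i. exponent_seq f i \<noteq> 0"
    using exponent_seq_inject[of f 1] assms by (force simp: exponent_seq_def)
  ultimately show ?thesis
    by (simp add: nonzero_seqs_def exponent_seq_def)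
qed

text \<open>After removing the gcd from the exponents, comparing multiplicities shows that
  \<open>b'\<close> divides each multiplicity of \<open>f\<close>, by coprimality. So
  \<open>f\<close> is a \<open>b'\<close>-th power \<open>h ^ b'\<close>, and taking
  \<open>b'\<close>-th roots yields \<open>g = h ^ a'\<close>.\<close>

lemma power_eq_power_imp_common_root:
  fixes f g :: nat
  assumes "f ^ a = g ^ b" "a > 0" "b > 0"
  obtains h m n where "f = h ^ m" "g = h ^ n"
proof -
  obtain a' b' where ab: "a = gcd a b * a'" "b = gcd a b * b'" "coprime a' b'"
    using assms by (metis gcd_coprime_exists mult.commute gcd_nat.eq_neutr_iff less_irrefl)
  have pos: "gcd a b > 0" "a' > 0" "b' > 0"
    using assms ab by (metis gcd_pos_nat bot_nat_0.not_eq_extremum mult_0_right)+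
  have "(f ^ a') ^ gcd a b = (g ^ b') ^ gcd a b"
    using assms ab by (metis power_mult mult.commute)
  then have eq: "f ^ a' = g ^ b'"
    using pos by (simp add: power_eq_iff_eq_base)
  have "b' dvd multiplicity p f" if "prime p" for p
  proof (cases "f = 0 \<or> g = 0")
    case True
    \<comment> \<open>Here \<open>f = 0\<close>, and the multiplicity of any prime in 0 is 0 by
      convention.\<close>
    then show ?thesis
      using eq pos by (auto simp: power_0_left)
  next
    case False
    then have "a' * multiplicity p f = b' * multiplicity p g"
      using arg_cong[OF eq, of "multiplicity p"] that
      by (simp add: prime_elem_multiplicity_power_distrib)
    then show ?thesis
      using \<open>coprime a' b'\<close> by (metis coprime_commute coprime_dvd_mult_right_iff dvd_triv_left)
  qed
  then have "is_nth_power b' f"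
    using pos by (simp add: is_nth_power_conv_multiplicity_nat)
  then obtain h where h: "f = h ^ b'"
    by (auto elim: is_nth_powerE)
  then have "(h ^ a') ^ b' = g ^ b'"
    using eq by (metis power_mult mult.commute)
  then have "g = h ^ a'"
    using pos by (simp add: power_eq_iff_eq_base)
  with h show ?thesis
    using that by blast
qed

text \<open>Writing the ratio as \<open>p / q\<close> turns proportionality into equality of the
  exponent sequences of \<open>f ^ q\<close> and \<open>g ^ p\<close>.\<close>

lemma proportional_imp_common_root:
  assumes "f > 1" "g > 1" "(exponent_seq f, exponent_seq g) \<in> proj_rel"
  obtains h m n where "f = h ^ m" "g = h ^ n"
proof -
  obtain c where c: "c > 0" "\<And>i. exponent_seq f i = c * exponent_seq g i"
    using assms by (auto simp: proj_rel_def)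
  obtain p q where pq: "c = of_int p / of_int q" "q > 0"
    by (cases c) (metis Fract_of_int_quotient)
  then have "p > 0"
    using c by (simp add: zero_less_divide_iff)
  have "f ^ nat q = g ^ nat p"
    by (rule exponent_seq_inject) 
       (use assms c pq \<open>p > 0\<close> in \<open>auto simp: exponent_seq_power field_simps\<close>)
  then show ?thesis
    by (rule power_eq_power_imp_common_root) (use that pq \<open>p > 0\<close> in auto)
qed

section \<open>Integers with a prescribed projective class\<close>

lemma finite_common_denominator:
  fixes a :: "'a \<Rightarrow> rat"
  assumes "finite I" "\<And>i. i \<in> I \<Longrightarrow> a i \<ge> 0"
  obtains d :: nat and e where "d > 0" "\<And>i. i \<in> I \<Longrightarrow> of_nat d * a i = of_nat (e i)"
proof -
  have "\<exists>d>0. \<forall>i\<in>I. \<exists>n. of_nat d * a i = of_nat n"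
    using assms
  proof (induction I)
    case (insert j I)
    then obtain d where d: "d > 0" "\<And>i. i \<in> I \<Longrightarrow> \<exists>n. of_nat d * a i = of_nat n"
      by auto
    obtain p q where pq: "a j = of_int p / of_int q" "q > 0"
      by (cases "a j") (metis Fract_of_int_quotient)
    then have "p \<ge> 0"
      using insert.prems[of j] by (simp add: zero_le_divide_iff)
    \<comment> \<open>The factor \<open>q\<close> clears the denominator of the new value, while
      \<open>d\<close> already clears the others.\<close>
    have "\<exists>n. of_nat (nat q * d) * a i = of_nat n" if "i \<in> insert j I" for i
    proof (cases "i = j")
      case True
      then have "of_nat (nat q * d) * a i = of_nat (nat p * d)"
        using pq \<open>p \<ge> 0\<close> by simp
      then show ?thesis ..
    next
      case False
      with that d(2)[of i] obtain n where "of_nat d * a i = of_nat n"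
        by auto
      then have "of_nat (nat q * d) * a i = of_nat (nat q * n)"
        by (simp add: mult.assoc)
      then show ?thesis ..
    qed
    moreover have "nat q * d > 0"
      using pq d by simp
    ultimately show ?case
      by blast
  qed auto
  then show ?thesis
    using that by metis
qed

lemma ex_proportional_exponent_seq:
  assumes "a \<in> nonzero_seqs"
  obtains f where "f > 1" "(a, exponent_seq f) \<in> proj_rel"
proof -
  define I where "I = {i. a i \<noteq> 0}"
  have I: "finite I" "\<And>i. a i \<ge> 0" "I \<noteq> {}"
    using assms by (auto simp: nonzero_seqs_def I_def)
  obtain d :: nat and e where d: "d > 0" "\<And>i. i \<in> I \<Longrightarrow> of_nat d * a i = of_nat (e i)"
    using finite_common_denominator[of I a] I by metis
  \<comment> \<open>The cleared values \<open>e i\<close> become the exponents. The product is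
    indexed by primes rather than positions, to fit \<open>multiplicity_prod_prime_powers\<close>,
    so \<open>inv nth_prime\<close> recovers the position.\<close>
  define f where "f = (\<Prod>p\<in>nth_prime ` I. p ^ e (inv nth_prime p))"
  have inj: "inj nth_prime"
    using bij_betw_nth_prime by (simp add: bij_betw_def)
  have "multiplicity (nth_prime i) f = (if i \<in> I then e i else 0)" for i
    unfolding f_def using I(1) inj
    by (subst multiplicity_prod_prime_powers) (auto simp: prime_nth_prime inj_image_mem_iff)
  then have eq: "exponent_seq f i = of_nat d * a i" for i
    using d(2)[of i] by (auto simp: exponent_seq_def I_def)
  have "f > 0"
    unfolding f_def by (intro prod_pos) (auto simp: prime_gt_0_nat prime_nth_prime)
  moreover have "f \<noteq> 1"
  proof
    assume "f = 1"
    then have "a i = 0" for i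
      using eq[of i] d(1) by (simp add: exponent_seq_def)
    then show False
      using I by (simp add: I_def)
  qed
  ultimately have "f > 1"
    by simp
  moreover have "\<forall>i. a i = inverse (of_nat d) * exponent_seq f i"
    using d(1) by (simp add: eq)
  then have "(a, exponent_seq f) \<in> proj_rel"
    using assms exponent_seq_in_nonzero_seqs[OF \<open>f > 1\<close>] d(1)
    unfolding proj_rel_def by (auto intro!: exI[of _ "inverse (of_nat d)"])
  ultimately show ?thesis
    by (rule that)
qed

section \<open>Injectivity and surjectivity\<close>

lemma proj_point_eq_iff:
  "a \<in> nonzero_seqs \<Longrightarrow> b \<in> nonzero_seqs \<Longrightarrow> proj_point a = proj_point b \<longleftrightarrow> (a, b) \<in> proj_rel"
  unfolding proj_point_def using eq_equiv_class_iff[OF equiv_proj_rel] by blast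

lemma exponent_point_eq: "is_generator f S \<Longrightarrow> exponent_point S = proj_point (exponent_seq f)"
  by (simp add: exponent_point_def the_generator)

lemma maximal_singly_generatedE:
  assumes "S \<in> maximal_singly_generated"
  obtains f where "f > 1" "is_generator f S"
  using assms is_generator_gt_1
  by (auto simp: maximal_singly_generated_def singly_generated_def)

text \<open>A root \<open>h\<close> of the generator can be neither 0 nor 1, so
  \<open>powers h\<close> is a competitor containing \<open>S\<close>, and maximality
  applies.\<close>

lemma maximal_eq_powers:
  assumes "S \<in> maximal_singly_generated" "is_generator f S" "f = h ^ n"
  shows "S = powers h"
proof -
  have "h > 0" "h \<noteq> 1"
    using assms by (auto simp: is_generator_def intro: gr0I)
  then have "singly_generated (powers h)"
    by (auto simp: singly_generated_def is_generator_def)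
  moreover have "S \<subseteq> powers h"
    using assms powers_subset_iff by (auto simp: is_generator_def)
  ultimately show ?thesis
    using assms(1) by (auto simp: maximal_singly_generated_def)
qed

lemma inj_on_exponent_point: "inj_on exponent_point maximal_singly_generated"
proof (rule inj_onI)
  fix S T
  assume max: "S \<in> maximal_singly_generated" "T \<in> maximal_singly_generated"
    and eq: "exponent_point S = exponent_point T"
  obtain f g where fg: "f > 1" "g > 1" and gen: "is_generator f S" "is_generator g T"
    using max by (meson maximal_singly_generatedE)
  have "(exponent_seq f, exponent_seq g) \<in> proj_rel"
    using eq fg gen by (simp add: exponent_point_eq proj_point_eq_iff exponent_seq_in_nonzero_seqs)
  then obtain h m n where "f = h ^ m" "g = h ^ n"
    using fg proportional_imp_common_root by blast
  then show "S = T"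
    using max gen maximal_eq_powers by blast
qed

lemma exponent_point_image: "exponent_point ` maximal_singly_generated = PF_inf"
proof (intro equalityI subsetI)
  fix P
  assume "P \<in> exponent_point ` maximal_singly_generated"
  then obtain S f where "P = exponent_point S" "f > 1" "is_generator f S"
    by (blast elim: maximal_singly_generatedE)
  then show "P \<in> PF_inf"
    unfolding PF_inf_def
    by (simp add: exponent_point_eq proj_point_def quotientI exponent_seq_in_nonzero_seqs)
next
  fix P
  assume "P \<in> PF_inf"
  then obtain a where a: "a \<in> nonzero_seqs" "P = proj_point a"
    by (auto simp: PF_inf_def proj_point_def elim: quotientE)
  obtain f where f: "f > 1" "(a, exponent_seq f) \<in> proj_rel"
    using ex_proportional_exponent_seq a by blast
  obtain h where h: "h > 1" "powers h \<in> maximal_singly_generated" "powers f \<subseteq> powers h"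
    using singly_generated_imp_subset_maximal f by blast
  then obtain n where n: "f = h ^ n"
    using powers_subset_iff by blast
  with f have "n > 0"
    by (intro gr0I) auto
  \<comment> \<open>Passing to the root \<open>h\<close> divides all exponents by \<open>n\<close>,
    so the scaling factor is \<open>n\<close>.\<close>
  then have "(exponent_seq f, exponent_seq h) \<in> proj_rel"
    using f h n by (auto simp: proj_rel_def exponent_seq_power exponent_seq_in_nonzero_seqs
        intro!: exI[of _ "of_nat n"])
  then have "(a, exponent_seq h) \<in> proj_rel"
    using f equiv_proj_rel by (meson equivE transE)
  then have "P = proj_point (exponent_seq h)"
    using a h by (simp add: proj_point_eq_iff exponent_seq_in_nonzero_seqs)
  also have "\<dots> = exponent_point (powers h)"
    using h exponent_point_eq[of h "powers h"] by (simp add: is_generator_def)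
  finally show "P \<in> exponent_point ` maximal_singly_generated"
    using h by blast
qed

theorem theorem7p5:
  shows "(\<forall>S \<in> maximal_singly_generated. \<forall>f. is_generator f S \<longrightarrow>
            exponent_point S = proj_point (exponent_seq f)) \<and>
         bij_betw exponent_point maximal_singly_generated PF_inf"
  unfolding bij_betw_def
  using exponent_point_eq inj_on_exponent_point exponent_point_image by blast

end
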